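(* Let $\mathbb{K}$ be a field of characteristic $0$, let $S=\mathbb{K}[x_1,\dots,x_l]$ with the standard grading, let $I$ be a homogeneous ideal of $S$, and let $\ell\in S_1$ be a linear form. Then the graded ring $S/I$ has the strong Lefschetz property (SLP) with strong Lefschetz element $\ell$ if and only if for every $s\ge 1$ and $d\ge 0$ $$\operatorname{HF}(S/(I+\langle \ell^s\rangle),d)=\max\{\operatorname{HF}(S/I,d)-\operatorname{HF}(S/I,d-s),\,0\},$$ where $\operatorname{HF}(S/I,r)=0$ for all $r<0$.
   Context: $\operatorname{HF}(S/I,d)=\dim_{\mathbb{K}}(S/I)_d$ is the Hilbert function. A linear map between finite-dimensional spaces is full-rank if it is injective or surjective. A graded ring $R=\bigoplus_{i\ge0}R_i$ over $\mathbb{K}$ with $\dim_{\mathbb{K}}R_i<\infty$ (not necessarily Artinian) has the SLP with strong Lefschetz element $\ell\in R_1$ if the multiplication map $\times\ell^s\colon R_i\to R_{i+s}$ is full-rank for every $i\ge0$ and $s\ge1$. For $R=S/I$, a linear form of $S$ is identified with its class in $R_1$. *)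

theory Defs
  imports
    "HOL-Library.Poly_Mapping"
    "HOL-Algebra.QuotRing"
    "Jordan_Normal_Form.VS_Connect"
begin

text \<open>
  \<open>G i\<close> is the graded piece of degree \<open>i\<close> of the \<open>K\<close>-algebra \<open>A\<close>. Every graded piece is
  finite-dimensional, but infinitely many of them may be nonzero.
\<close>

locale graded_algebra =
  fixes K :: "('a, 'c) ring_scheme" and A :: "('a, 'b, 'd) module_scheme"
    and G :: "nat \<Rightarrow> 'b set"
  assumes field: "field K"
    and algebra: "algebra K A"
    and grade_submodule: "submodule K (G i) A"
    and grade_fin_dim: "vectorspace.fin_dim K (A\<lparr>carrier := G i\<rparr>)"
    and grade_one: "\<one>\<^bsub>A\<^esub> \<in> G 0"
    and grade_mult: "\<lbrakk>x \<in> G i; y \<in> G j\<rbrakk> \<Longrightarrow> x \<otimes>\<^bsub>A\<^esub> y \<in> G (i + j)"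
    and grade_decomp: "x \<in> carrier A \<Longrightarrow>
      \<exists>!c. (\<forall>i. c i \<in> G i) \<and> finite {i. c i \<noteq> \<zero>\<^bsub>A\<^esub>}
           \<and> x = (\<Oplus>\<^bsub>A\<^esub>i\<in>{i. c i \<noteq> \<zero>\<^bsub>A\<^esub>}. c i)"

definition full_rank :: "('b \<Rightarrow> 'c) \<Rightarrow> 'b set \<Rightarrow> 'c set \<Rightarrow> bool" where
  "full_rank f V W \<longleftrightarrow> inj_on f V \<or> f ` V = W"

definition strong_lefschetz_element ::
  "('b, 'd) ring_scheme \<Rightarrow> (nat \<Rightarrow> 'b set) \<Rightarrow> 'b \<Rightarrow> bool" where
  "strong_lefschetz_element R G ell \<longleftrightarrow>
     ell \<in> G 1 \<and>
     (\<forall>i s. 1 \<le> s \<longrightarrow> full_rank (\<lambda>x. (ell [^]\<^bsub>R\<^esub> s) \<otimes>\<^bsub>R\<^esub> x) (G i) (G (i + s)))"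


text \<open>
  The variables are indexed by a finite type \<open>'n\<close>, so the number \<open>l\<close> of variables is
  \<open>CARD('n)\<close>. A monomial is given by its exponent vector, of type \<open>'n \<Rightarrow>\<^sub>0 nat\<close>. As a ring in
  the sense of \<open>HOL-Algebra\<close>, the polynomial ring is \<^term>\<open>class_ring\<close> at type
  \<open>('n, 'k) mpoly\<close>, and the ground field is \<^term>\<open>class_ring\<close> at type \<open>'k\<close>.
\<close>

type_synonym ('n, 'k) mpoly = "('n \<Rightarrow>\<^sub>0 nat) \<Rightarrow>\<^sub>0 'k"

definition mon_degree :: "('n::finite \<Rightarrow>\<^sub>0 nat) \<Rightarrow> nat" where
  "mon_degree m = (\<Sum>i\<in>UNIV. Poly_Mapping.lookup m i)"

definition homogeneous_part :: "nat \<Rightarrow> ('n::finite, 'k::zero) mpoly set" where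
  "homogeneous_part d = {p. \<forall>m\<in>Poly_Mapping.keys p. mon_degree m = d}"

definition homogeneous_component ::
  "nat \<Rightarrow> ('n::finite, 'k::comm_monoid_add) mpoly \<Rightarrow> ('n, 'k) mpoly" where
  "homogeneous_component d p =
     (\<Sum>m\<in>{m \<in> Poly_Mapping.keys p. mon_degree m = d}. Poly_Mapping.single m (Poly_Mapping.lookup p m))"

definition homogeneous_ideal :: "('n::finite, 'k::field) mpoly set \<Rightarrow> bool" where
  "homogeneous_ideal I \<longleftrightarrow>
     ideal I class_ring \<and> (\<forall>p\<in>I. \<forall>d. homogeneous_component d p \<in> I)"

text \<open>A scalar \<open>c\<close> acts on the quotient ring as multiplication by the class of the constant
  polynomial \<open>c\<close>.\<close>

definition quotient_algebra ::
  "('n::finite, 'k::field) mpoly set \<Rightarrow> ('k, ('n, 'k) mpoly set) module" where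
  "quotient_algebra I =
     \<lparr>carrier = carrier (class_ring Quot I),
      mult = mult (class_ring Quot I),
      one = one (class_ring Quot I),
      zero = zero (class_ring Quot I),
      add = add (class_ring Quot I),
      smult = (\<lambda>c X. (I +>\<^bsub>class_ring\<^esub> Poly_Mapping.single 0 c) \<otimes>\<^bsub>class_ring Quot I\<^esub> X)\<rparr>"

definition quotient_grade ::
  "('n::finite, 'k::field) mpoly set \<Rightarrow> nat \<Rightarrow> ('n, 'k) mpoly set set" where
  "quotient_grade I d = (\<lambda>p. I +>\<^bsub>class_ring\<^esub> p) ` homogeneous_part d"

definition HF :: "('n::finite, 'k::field) mpoly set \<Rightarrow> int \<Rightarrow> nat" where
  "HF I r =
     (if r < 0 then 0
      else vectorspace.dim (class_ring :: 'k ring)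
             ((quotient_algebra I)\<lparr>carrier := quotient_grade I (nat r)\<rparr>))"

lemma homogeneous_part_0: "0 \<in> homogeneous_part d"
  by (simp add: homogeneous_part_def)

lemma homogeneous_part_add:
  "p \<in> homogeneous_part d \<Longrightarrow> q \<in> homogeneous_part d \<Longrightarrow> p + q \<in> homogeneous_part d"
  using keys_add[of p q] by (auto simp: homogeneous_part_def)

lemma homogeneous_part_diff:
  "p \<in> homogeneous_part d \<Longrightarrow> q \<in> homogeneous_part d \<Longrightarrow> p - q \<in> homogeneous_part d"
  for p q :: "('n::finite, 'k::ab_group_add) mpoly"
  by (auto simp: homogeneous_part_def in_keys_iff lookup_minus)

lemma mon_degree_add: "mon_degree (m + m') = mon_degree m + mon_degree m'"
  by (simp add: mon_degree_def lookup_add sum.distrib)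

lemma homogeneous_part_mult:
  "p \<in> homogeneous_part d \<Longrightarrow> q \<in> homogeneous_part e \<Longrightarrow> p * q \<in> homogeneous_part (d + e)"
  using keys_mult[of p q] by (force simp: homogeneous_part_def mon_degree_add)

lemma homogeneous_part_const: "Poly_Mapping.single 0 c \<in> homogeneous_part 0"
  by (simp add: homogeneous_part_def mon_degree_def)

lemma lookup_homogeneous_component:
  "Poly_Mapping.lookup (homogeneous_component d p) m = (if mon_degree m = d then Poly_Mapping.lookup p m else 0)"
  by (auto simp: homogeneous_component_def lookup_sum lookup_single when_def in_keys_iff
      sum.delta')

lemma homogeneous_component_in: "homogeneous_component d p \<in> homogeneous_part d"
  by (auto simp: homogeneous_part_def in_keys_iff lookup_homogeneous_component split: if_splits)

lemma homogeneous_component_nonzero: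
  assumes "homogeneous_component d p \<noteq> 0" shows "d \<in> mon_degree ` Poly_Mapping.keys p"
proof -
  obtain m where "Poly_Mapping.lookup (homogeneous_component d p) m \<noteq> 0"
    using assms by (metis poly_mapping_eqI lookup_zero)
  then show ?thesis by (auto simp: lookup_homogeneous_component in_keys_iff split: if_splits)
qed

lemma homogeneous_component_sum:
  assumes "finite D" "mon_degree ` Poly_Mapping.keys p \<subseteq> D"
  shows "p = (\<Sum>d\<in>D. homogeneous_component d p)"
proof (rule poly_mapping_eqI)
  fix m
  show "Poly_Mapping.lookup p m = Poly_Mapping.lookup (\<Sum>d\<in>D. homogeneous_component d p) m"
    using assms
    by (cases "m \<in> Poly_Mapping.keys p")
      (auto simp: lookup_sum lookup_homogeneous_component in_keys_iff sum.delta')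
qed

lemma homogeneous_component_of_sum:
  assumes "finite D" "\<And>d. f d \<in> homogeneous_part d" "e \<in> D"
  shows "homogeneous_component e (\<Sum>d\<in>D. f d) = f e"
proof (rule poly_mapping_eqI)
  fix m
  have *: "Poly_Mapping.lookup (f d) m = (if d = mon_degree m then Poly_Mapping.lookup (f d) m else 0)" for d
    using assms(2)[of d] by (auto simp: homogeneous_part_def in_keys_iff)
  have "(\<Sum>d\<in>D. Poly_Mapping.lookup (f d) m) = (if mon_degree m \<in> D then Poly_Mapping.lookup (f (mon_degree m)) m else 0)"
    by (subst *, subst sum.delta) (use assms(1) in auto)
  then show "Poly_Mapping.lookup (homogeneous_component e (\<Sum>d\<in>D. f d)) m = Poly_Mapping.lookup (f e) m"
    using *[of e] assms(3) by (auto simp: lookup_sum lookup_homogeneous_component)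
qed

lemma finite_mon_degree: "finite {m :: 'n::finite \<Rightarrow>\<^sub>0 nat. mon_degree m = d}"
proof (rule finite_subset)
  show "{m :: 'n \<Rightarrow>\<^sub>0 nat. mon_degree m = d} \<subseteq> Abs_poly_mapping ` (PiE UNIV (\<lambda>_. {..d}))"
  proof
    fix m :: "'n \<Rightarrow>\<^sub>0 nat" assume "m \<in> {m. mon_degree m = d}"
    then have "Poly_Mapping.lookup m i \<le> d" for i
      using member_le_sum[of i UNIV "Poly_Mapping.lookup m"] by (auto simp: mon_degree_def)
    then show "m \<in> Abs_poly_mapping ` (PiE UNIV (\<lambda>_. {..d}))"
      by (intro image_eqI[of _ _ "Poly_Mapping.lookup m"]) (auto simp: lookup_inverse)
  qed
qed (simp add: finite_PiE)

context
  fixes I :: "('n::finite, 'k::field) mpoly set"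
  assumes I: "ideal I class_ring"
begin

interpretation I: ideal I "class_ring :: ('n, 'k) mpoly ring" by (rule I)

abbreviation (input) cls :: "('n, 'k) mpoly \<Rightarrow> ('n, 'k) mpoly set" where
  "cls p \<equiv> I +>\<^bsub>class_ring\<^esub> p"

lemma quotient_ring_hom:
  "ring_hom_cring (class_ring :: ('n, 'k) mpoly ring) (class_ring Quot I) (\<lambda>p. cls p)"
  using I.rcos_ring_hom_cring[OF class_cring.is_cring] by simp

interpretation h: ring_hom_cring "class_ring :: ('n, 'k) mpoly ring" "class_ring Quot I" "\<lambda>p. cls p"
  by (rule quotient_ring_hom)

lemma cls_add: "cls (p + q) = cls p \<oplus>\<^bsub>quotient_algebra I\<^esub> cls q"
  using h.hom_add[of p q] by (simp add: quotient_algebra_def)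

lemma cls_mult: "cls (p * q) = cls p \<otimes>\<^bsub>quotient_algebra I\<^esub> cls q"
  using h.hom_mult[of p q] by (simp add: quotient_algebra_def)

lemma cls_zero: "cls 0 = \<zero>\<^bsub>quotient_algebra I\<^esub>"
  using h.hom_zero by (simp add: quotient_algebra_def)

lemma cls_one: "cls 1 = \<one>\<^bsub>quotient_algebra I\<^esub>"
  using h.hom_one by (simp add: quotient_algebra_def)

lemma cls_smult: "c \<odot>\<^bsub>quotient_algebra I\<^esub> cls p = cls (Poly_Mapping.single 0 c * p)"
  using h.hom_mult[of "Poly_Mapping.single 0 c" p] by (simp add: quotient_algebra_def)

lemma quotient_algebra_carrier: "carrier (quotient_algebra I) = range (\<lambda>p. cls p)"
  by (auto simp: quotient_algebra_def FactRing_def A_RCOSETS_def')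

lemma cls_eq_iff: "cls p = cls q \<longleftrightarrow> p - q \<in> I"
proof -
  have eq: "cls p = {i + p | i. i \<in> I}" for p by (auto simp: a_r_coset_def')
  have add: "i + j \<in> I" if "i \<in> I" "j \<in> I" for i j using I.a_closed[OF that] by simp
  have neg: "- i \<in> I" if "i \<in> I" for i
    using I.a_inv_closed[OF that] by (simp add: class_ring_simps)
  have zero: "0 \<in> I" using I.zero_closed by simp
  show ?thesis
  proof
    assume "cls p = cls q"
    moreover have "p \<in> cls p" unfolding eq using zero by force
    ultimately have "p \<in> cls q" by simp
    then show "p - q \<in> I" unfolding eq by auto
  next
    assume d: "p - q \<in> I"
    show "cls p = cls q"
    proof (intro equalityI subsetI)
      fix x assume "x \<in> cls p"
      then obtain i where "i \<in> I" "x = i + p" unfolding eq by auto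
      then show "x \<in> cls q" unfolding eq
        using add[of i "p - q"] d by (auto intro!: exI[of _ "i + (p - q)"])
    next
      fix x assume "x \<in> cls q"
      then obtain i where "i \<in> I" "x = i + q" unfolding eq by auto
      then show "x \<in> cls p" unfolding eq
        using add[of i "- (p - q)"] neg[OF d] by (auto intro!: exI[of _ "i + (q - p)"])
    qed
  qed
qed

lemma quotient_algebra_algebra: "algebra (class_ring :: 'k ring) (quotient_algebra I)"
proof (rule algebraI)
  let ?A = "quotient_algebra I"
  show "cring (class_ring :: 'k ring)" by (rule class_cring.is_cring)
  show "cring ?A"
  proof (rule cringI)
    show "abelian_group ?A"
      by (rule abelian_groupI)
        (auto simp: quotient_algebra_def h.S.add.m_ac intro: h.S.add.l_inv_ex)
    show "comm_monoid ?A"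
      by (rule comm_monoidI) (auto simp: quotient_algebra_def h.S.m_ac)
  qed (auto simp: quotient_algebra_def h.S.l_distr)
next
  fix a b :: 'k and x y
  assume "x \<in> carrier (quotient_algebra I)" "y \<in> carrier (quotient_algebra I)"
  then obtain p q where [simp]: "x = cls p" "y = cls q" by (auto simp: quotient_algebra_carrier)
  show "a \<odot>\<^bsub>quotient_algebra I\<^esub> (x \<oplus>\<^bsub>quotient_algebra I\<^esub> y)
      = a \<odot>\<^bsub>quotient_algebra I\<^esub> x \<oplus>\<^bsub>quotient_algebra I\<^esub> a \<odot>\<^bsub>quotient_algebra I\<^esub> y"
    by (simp add: cls_smult distrib_left flip: cls_add)
  show "(a \<odot>\<^bsub>quotient_algebra I\<^esub> x) \<otimes>\<^bsub>quotient_algebra I\<^esub> y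
      = a \<odot>\<^bsub>quotient_algebra I\<^esub> (x \<otimes>\<^bsub>quotient_algebra I\<^esub> y)"
    by (simp add: cls_smult mult.assoc flip: cls_mult)
next
  fix a b :: 'k and x
  assume "x \<in> carrier (quotient_algebra I)"
  then obtain p where [simp]: "x = cls p" by (auto simp: quotient_algebra_carrier)
  show "a \<odot>\<^bsub>quotient_algebra I\<^esub> x \<in> carrier (quotient_algebra I)"
    by (simp add: cls_smult quotient_algebra_carrier)
  show "(a \<oplus>\<^bsub>class_ring\<^esub> b) \<odot>\<^bsub>quotient_algebra I\<^esub> x
      = a \<odot>\<^bsub>quotient_algebra I\<^esub> x \<oplus>\<^bsub>quotient_algebra I\<^esub> b \<odot>\<^bsub>quotient_algebra I\<^esub> x"
    by (simp add: cls_smult single_add distrib_right flip: cls_add)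
  show "(a \<otimes>\<^bsub>class_ring\<^esub> b) \<odot>\<^bsub>quotient_algebra I\<^esub> x
      = a \<odot>\<^bsub>quotient_algebra I\<^esub> (b \<odot>\<^bsub>quotient_algebra I\<^esub> x)"
    by (simp add: cls_smult mult_single flip: mult.assoc)
  show "\<one>\<^bsub>class_ring\<^esub> \<odot>\<^bsub>quotient_algebra I\<^esub> x = x"
    by (simp add: cls_smult single_one)
qed

interpretation A: algebra "class_ring :: 'k ring" "quotient_algebra I"
  by (rule quotient_algebra_algebra)

lemma cls_sum:
  "finite D \<Longrightarrow> (\<Oplus>\<^bsub>quotient_algebra I\<^esub>d\<in>D. cls (f d)) = cls (\<Sum>d\<in>D. f d)"
proof (induction D rule: finite_induct)
  case empty
  show ?case by (simp add: cls_zero)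
next
  case (insert d D)
  have "(\<lambda>d. cls (f d)) \<in> insert d D \<rightarrow> carrier (quotient_algebra I)"
    by (auto simp: quotient_algebra_carrier)
  with insert show ?case by (subst A.M.finsum_insert) (auto simp: cls_add)
qed

lemma quotient_grade_submodule:
  "submodule (class_ring :: 'k ring) (quotient_grade I d) (quotient_algebra I)"
proof (rule submodule.intro)
  show "module (class_ring :: 'k ring) (quotient_algebra I)" by (rule A.module)
  show "quotient_grade I d \<subseteq> carrier (quotient_algebra I)"
    by (auto simp: quotient_grade_def quotient_algebra_carrier)
  show "\<zero>\<^bsub>quotient_algebra I\<^esub> \<in> quotient_grade I d"
    unfolding quotient_grade_def cls_zero[symmetric] using homogeneous_part_0 by blast
  show "v \<oplus>\<^bsub>quotient_algebra I\<^esub> w \<in> quotient_grade I d"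
    if "v \<in> quotient_grade I d" "w \<in> quotient_grade I d" for v w
    using that homogeneous_part_add
    by (auto simp: quotient_grade_def simp flip: cls_add intro!: imageI)
  show "c \<odot>\<^bsub>quotient_algebra I\<^esub> v \<in> quotient_grade I d"
    if "v \<in> quotient_grade I d" for c v
    using that homogeneous_part_mult[OF homogeneous_part_const, of _ d]
    by (auto simp: quotient_grade_def cls_smult intro!: imageI)
qed

lemma quotient_grade_vectorspace:
  "vectorspace (class_ring :: 'k ring) ((quotient_algebra I)\<lparr>carrier := quotient_grade I d\<rparr>)"
  using A.submodule_is_module[OF quotient_grade_submodule] class_field
  by (simp add: vectorspace_def)

lemma quotient_grade_fin_dim:
  "vectorspace.fin_dim (class_ring :: 'k ring)
     ((quotient_algebra I)\<lparr>carrier := quotient_grade I d\<rparr>)"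
proof -
  let ?V = "(quotient_algebra I)\<lparr>carrier := quotient_grade I d\<rparr>"
  interpret V: vectorspace "class_ring :: 'k ring" ?V by (rule quotient_grade_vectorspace)
  let ?M = "{m :: 'n \<Rightarrow>\<^sub>0 nat. mon_degree m = d}"
  let ?S = "(\<lambda>m. cls (Poly_Mapping.single m 1)) ` ?M"
  have S: "?S \<subseteq> carrier ?V"
    by (auto simp: quotient_grade_def homogeneous_part_def intro!: imageI)
  interpret sp: submodule "class_ring :: 'k ring" "V.span ?S" ?V
    by (rule V.span_is_submodule[OF S])
  have span: "cls (\<Sum>m\<in>N. Poly_Mapping.single m (g m)) \<in> V.span ?S"
    if "finite N" "N \<subseteq> ?M" for N g
    using that
  proof (induction N rule: finite_induct)
    case empty
    show ?case using sp.zero_closed by (simp add: cls_zero)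
  next
    case (insert m N)
    have "cls (Poly_Mapping.single m 1) \<in> V.span ?S"
      using V.in_own_span[OF S] insert.prems by blast
    then have "g m \<odot>\<^bsub>?V\<^esub> cls (Poly_Mapping.single m 1) \<in> V.span ?S"
      by (intro sp.smult_closed) auto
    then have "cls (Poly_Mapping.single m (g m)) \<in> V.span ?S"
      by (simp add: cls_smult mult_single)
    with insert show ?case using sp.m_closed by (auto simp: cls_add)
  qed
  have "carrier ?V \<subseteq> V.span ?S"
  proof
    fix x assume "x \<in> carrier ?V"
    then obtain p where p: "p \<in> homogeneous_part d" "x = cls p" by (auto simp: quotient_grade_def)
    have "p = (\<Sum>m\<in>Poly_Mapping.keys p. Poly_Mapping.single m (Poly_Mapping.lookup p m))"
      by (rule poly_mapping_eqI)
        (auto simp: lookup_sum lookup_single when_def in_keys_iff sum.delta')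
    moreover have "Poly_Mapping.keys p \<subseteq> ?M" using p(1) by (auto simp: homogeneous_part_def)
    ultimately show "x \<in> V.span ?S"
      using span[of "Poly_Mapping.keys p" "Poly_Mapping.lookup p"] p(2) by simp
  qed
  moreover have "V.span ?S \<subseteq> carrier ?V" by (rule sp.subset)
  ultimately show ?thesis
    unfolding V.fin_dim_def using S finite_imageI[OF finite_mon_degree] by (intro exI[of _ ?S]) auto
qed

lemma quotient_graded_algebra:
  assumes hom: "homogeneous_ideal I"
  shows "graded_algebra (class_ring :: 'k ring) (quotient_algebra I) (quotient_grade I)"
proof (rule graded_algebra.intro)
  let ?A = "quotient_algebra I"
  show "field (class_ring :: 'k ring)" by (rule class_field)
  show "algebra (class_ring :: 'k ring) ?A" by (rule quotient_algebra_algebra)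
  show "submodule (class_ring :: 'k ring) (quotient_grade I d) ?A" for d
    by (rule quotient_grade_submodule)
  show "vectorspace.fin_dim (class_ring :: 'k ring) (?A\<lparr>carrier := quotient_grade I d\<rparr>)" for d
    by (rule quotient_grade_fin_dim)
  show "\<one>\<^bsub>?A\<^esub> \<in> quotient_grade I 0"
    unfolding quotient_grade_def cls_one[symmetric]
    by (auto simp: homogeneous_part_def mon_degree_def intro!: imageI)
  show "x \<otimes>\<^bsub>?A\<^esub> y \<in> quotient_grade I (i + j)"
    if "x \<in> quotient_grade I i" "y \<in> quotient_grade I j" for x y i j
    using that homogeneous_part_mult by (auto simp: quotient_grade_def simp flip: cls_mult
        intro!: imageI)
  fix x assume "x \<in> carrier ?A"
  then obtain p where p: "x = cls p" by (auto simp: quotient_algebra_carrier)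
  let ?P = "\<lambda>c. (\<forall>i. c i \<in> quotient_grade I i) \<and> finite {i. c i \<noteq> \<zero>\<^bsub>?A\<^esub>}
           \<and> x = (\<Oplus>\<^bsub>?A\<^esub>i\<in>{i. c i \<noteq> \<zero>\<^bsub>?A\<^esub>}. c i)"
  let ?c = "\<lambda>d. cls (homogeneous_component d p)"
  let ?D = "mon_degree ` Poly_Mapping.keys p"
  have extend: "(\<Oplus>\<^bsub>?A\<^esub>i\<in>{i. c i \<noteq> \<zero>\<^bsub>?A\<^esub>}. c i) = (\<Oplus>\<^bsub>?A\<^esub>i\<in>D. c i)"
    if "finite D" "{i. c i \<noteq> \<zero>\<^bsub>?A\<^esub>} \<subseteq> D" "\<And>i. c i \<in> carrier ?A" for c and D :: "nat set"
    using that by (intro A.M.add.finprod_mono_neutral_cong_left) auto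
  have zero: "?c d = \<zero>\<^bsub>?A\<^esub>" if "d \<notin> ?D" for d
    using homogeneous_component_nonzero[of d p] that by (cases "homogeneous_component d p = 0") (simp_all add: cls_zero)
  show "\<exists>!c. ?P c"
  proof (rule ex1I[of _ ?c])
    have sub: "{i. ?c i \<noteq> \<zero>\<^bsub>?A\<^esub>} \<subseteq> ?D" using zero by blast
    have "x = (\<Oplus>\<^bsub>?A\<^esub>i\<in>?D. ?c i)"
      using p homogeneous_component_sum[of ?D p] cls_sum[of ?D "\<lambda>d. homogeneous_component d p"]
      by (metis finite_imageI finite_keys order_refl)
    moreover have "(\<Oplus>\<^bsub>?A\<^esub>i\<in>{i. ?c i \<noteq> \<zero>\<^bsub>?A\<^esub>}. ?c i) = (\<Oplus>\<^bsub>?A\<^esub>i\<in>?D. ?c i)"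
      by (rule extend[OF _ sub]) (simp_all add: quotient_algebra_carrier)
    ultimately have "x = (\<Oplus>\<^bsub>?A\<^esub>i\<in>{i. ?c i \<noteq> \<zero>\<^bsub>?A\<^esub>}. ?c i)"
      by (rule trans[OF _ sym])
    moreover have "?c i \<in> quotient_grade I i" for i
      unfolding quotient_grade_def by (rule imageI) (rule homogeneous_component_in)
    moreover have "finite {i. ?c i \<noteq> \<zero>\<^bsub>?A\<^esub>}"
      by (rule finite_subset[OF sub]) simp
    ultimately show "?P ?c" by blast
  next
    fix c assume c: "?P c"
    then have "\<forall>i. \<exists>f. f \<in> homogeneous_part i \<and> c i = cls f" by (auto simp: quotient_grade_def)
    then obtain f where f: "\<And>i. f i \<in> homogeneous_part i" "\<And>i. c i = cls (f i)" by metis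
    let ?E = "{i. c i \<noteq> \<zero>\<^bsub>?A\<^esub>} \<union> ?D"
    have fin: "finite ?E" using c by simp
    have "(\<Oplus>\<^bsub>?A\<^esub>i\<in>{i. c i \<noteq> \<zero>\<^bsub>?A\<^esub>}. c i) = (\<Oplus>\<^bsub>?A\<^esub>i\<in>?E. c i)"
      by (rule extend[OF fin]) (simp_all add: f(2) quotient_algebra_carrier)
    moreover have "(\<Oplus>\<^bsub>?A\<^esub>i\<in>?E. c i) = cls (\<Sum>i\<in>?E. f i)"
      unfolding f(2) by (rule cls_sum) (use fin in \<open>simp add: f(2)\<close>)
    ultimately have "cls p = cls (\<Sum>i\<in>?E. f i)" using c p by metis
    then have "p - (\<Sum>i\<in>?E. f i) \<in> I" by (rule cls_eq_iff[THEN iffD1])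
    moreover have "p = (\<Sum>i\<in>?E. homogeneous_component i p)"
      using fin by (rule homogeneous_component_sum) blast
    then have "p - (\<Sum>i\<in>?E. f i) = (\<Sum>i\<in>?E. homogeneous_component i p - f i)"
      unfolding sum_subtractf by (rule arg_cong)
    ultimately have *: "(\<Sum>i\<in>?E. homogeneous_component i p - f i) \<in> I"
      by (rule back_subst[where P = "\<lambda>q. q \<in> I"])
    have diff: "homogeneous_component i p - f i \<in> homogeneous_part i" for i
      by (rule homogeneous_part_diff[OF homogeneous_component_in f(1)])
    show "c = ?c"
    proof
      fix i
      show "c i = ?c i"
      proof (cases "i \<in> ?E")
        case True
        have "homogeneous_component i (\<Sum>i\<in>?E. homogeneous_component i p - f i)
            = homogeneous_component i p - f i"
          by (rule homogeneous_component_of_sum[OF fin diff True])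
        moreover have "homogeneous_component i (\<Sum>i\<in>?E. homogeneous_component i p - f i) \<in> I"
          using * hom unfolding homogeneous_ideal_def by blast
        ultimately have "homogeneous_component i p - f i \<in> I" by (rule subst)
        then have "?c i = cls (f i)" by (rule cls_eq_iff[THEN iffD2])
        then show ?thesis unfolding f(2) by (rule sym)
      next
        case False
        then have "c i = \<zero>\<^bsub>?A\<^esub>" "i \<notin> ?D" by blast+
        then show ?thesis using zero[of i] by (metis (no_types))
      qed
    qed
  qed
qed

end

end

theory Submission
  imports Defs
begin

text \<open>
  Write \<open>R = S/I\<close> and \<open>J = I + \<langle>\<ell>\<^sup>s\<rangle>\<close>. Since \<open>J\<close> is homogeneous, \<open>(S/J)\<^sub>d\<close> is the cokernel of
  multiplication by \<open>\<ell>\<^sup>s\<close> from \<open>R\<^sub>d\<^sub>-\<^sub>s\<close> to \<open>R\<^sub>d\<close>, and by rank-nullity a linear map between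
  finite-dimensional spaces \<open>V\<close> and \<open>W\<close> has full rank iff its cokernel has dimension
  \<open>max {dim W - dim V, 0}\<close>. For \<open>d < s\<close> the equation always holds, because \<open>J\<close> and \<open>I\<close> agree in
  degree \<open>d\<close>.
\<close>

section \<open>Linear algebra: injectivity and surjectivity read off from dimensions\<close>

text \<open>Independent subsets of \<open>W\<close> stay independent in \<open>V\<close>, so
  \<open>dim\<close> bounds their size. Hence a maximal one exists; it is finite and a basis of
  \<open>W\<close>.\<close>

lemma (in vectorspace) subspace_fin_dim:
  assumes "subspace K W V" "fin_dim"
  shows "vectorspace.fin_dim K (vs W)"
proof -
  interpret W: vectorspace K "vs W" by (rule subspace_is_vs[OF assms(1)])
  have W: "submodule K W V" using assms(1) by (simp add: subspace_def)
  have "\<exists>A. finite A \<and> maximal A (\<lambda>S. S \<subseteq> carrier (vs W) \<and> W.lin_indpt S)"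
  proof (rule maximal_exists[where N = dim and B = "{}"])
    fix A assume A: "A \<subseteq> carrier (vs W) \<and> W.lin_indpt A"
    then have "lin_indpt A" using span_li_not_depend(2)[OF _ W, of A] by simp
    moreover have "A \<subseteq> carrier V" using A submodule.subset[OF W] by auto
    ultimately show "finite A \<and> card A \<le> dim" using li_le_dim[OF assms(2)] by blast
  qed (auto simp: W.lin_dep_def)
  then obtain A where "finite A" "W.basis A" using W.max_li_is_basis by blast
  then show ?thesis by (auto simp: W.fin_dim_def W.basis_def)
qed

lemma (in vectorspace) dim_eq_0_iff:
  assumes "fin_dim"
  shows "dim = 0 \<longleftrightarrow> carrier V = {\<zero>\<^bsub>V\<^esub>}"
proof
  obtain B where B: "finite B" "basis B" using finite_basis_exists[OF assms] by blast
  assume "dim = 0"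
  then have "B = {}" using dim_basis[OF B] B(1) by simp
  then show "carrier V = {\<zero>\<^bsub>V\<^esub>}" using B(2) by (simp add: basis_def span_empty)
next
  assume "carrier V = {\<zero>\<^bsub>V\<^esub>}"
  then have "gen_set {\<zero>\<^bsub>V\<^esub>}"
    using span_zero[of "{\<zero>\<^bsub>V\<^esub>}"] span_is_subset2[of "{\<zero>\<^bsub>V\<^esub>}"]
    by (metis order_refl singleton_insert_inj_eq subset_singletonD empty_iff)
  then show "dim = 0" by (rule dim0I)
qed

text \<open>Makes injectivity a numerical condition that rank-nullity can use. The kernel inherits
  finite dimension from \<open>V\<close>, which is what lets dimension 0 force it to be
  trivial.\<close>

lemma (in linear_map) inj_on_iff_dim_ker:
  assumes "V.fin_dim"
  shows "inj_on T (carrier V) \<longleftrightarrow> vectorspace.dim K (V.vs kerT) = 0"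
proof -
  interpret Ker: vectorspace K "V.vs kerT" by (rule V.subspace_is_vs[OF kerT_is_subspace])
  show ?thesis
    using Ker.dim_eq_0_iff[OF V.subspace_fin_dim[OF kerT_is_subspace assms]] Ke0_iff_inj by simp
qed

text \<open>The hypotheses \<open>ker\<close> and \<open>surj\<close> describe \<open>Q\<close> as a
  cokernel of \<open>T\<close> without forming a quotient space, so that a graded piece of another
  quotient ring can take its place.\<close>

lemma full_rank_iff_dim_coker:
  assumes T: "linear_map K V W T" and U: "linear_map K W Q U"
    and V_fin: "vectorspace.fin_dim K V" and W_fin: "vectorspace.fin_dim K W"
    and ker: "{w \<in> carrier W. U w = \<zero>\<^bsub>Q\<^esub>} = T ` carrier V"
    and surj: "U ` carrier W = carrier Q"
  shows "full_rank T (carrier V) (carrier W) \<longleftrightarrow>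
    int (vectorspace.dim K Q) = max (int (vectorspace.dim K W) - int (vectorspace.dim K V)) 0"
proof -
  interpret T: linear_map K V W T by (rule T)
  interpret U: linear_map K W Q U by (rule U)
  have kerU: "U.ker = T.im" using ker by (simp add: U.ker_def T.im_def)
  have imU: "Q\<lparr>carrier := U.im\<rparr> = Q" using surj by (simp add: U.im_def)
  have rT: "vectorspace.dim K (W\<lparr>carrier := T.im\<rparr>) + vectorspace.dim K (V\<lparr>carrier := T.ker\<rparr>)
      = vectorspace.dim K V"
    by (rule T.rank_nullity[OF V_fin])
  have rU: "vectorspace.dim K Q + vectorspace.dim K (W\<lparr>carrier := T.im\<rparr>) = vectorspace.dim K W"
    using U.rank_nullity[OF W_fin] by (simp add: kerU imU)
  have inj: "inj_on T (carrier V) \<longleftrightarrow> vectorspace.dim K (V\<lparr>carrier := T.ker\<rparr>) = 0"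
    by (rule T.inj_on_iff_dim_ker[OF V_fin])
  have "T ` carrier V = carrier W \<longleftrightarrow> carrier Q = {\<zero>\<^bsub>Q\<^esub>}"
  proof
    assume "T ` carrier V = carrier W"
    then have "U w = \<zero>\<^bsub>Q\<^esub>" if "w \<in> carrier W" for w using ker that by blast
    then have "carrier Q \<subseteq> {\<zero>\<^bsub>Q\<^esub>}" unfolding surj[symmetric] by (simp add: image_subset_iff)
    then show "carrier Q = {\<zero>\<^bsub>Q\<^esub>}" using U.W.module.M.zero_closed by (metis subset_singletonD empty_iff)
  next
    assume "carrier Q = {\<zero>\<^bsub>Q\<^esub>}"
    then have "U w = \<zero>\<^bsub>Q\<^esub>" if "w \<in> carrier W" for w using U.T_im[OF that] by simp
    then show "T ` carrier V = carrier W" unfolding ker[symmetric] by blast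
  qed
  also have "\<dots> \<longleftrightarrow> vectorspace.dim K Q = 0"
    using U.W.dim_eq_0_iff[OF U.surj_fin_dim[OF W_fin surj]] by simp
  \<comment> \<open>Adding up \<open>rT\<close> and \<open>rU\<close> gives dim \<open>Q\<close> =
    dim \<open>W\<close> - dim \<open>V\<close> + dim ker \<open>T\<close>. Hence dim
    \<open>Q\<close> equals the maximum iff dim ker \<open>T\<close> = 0 or dim \<open>Q\<close> =
    0, that is, iff \<open>T\<close> is injective or surjective.\<close>
  finally show ?thesis using rT rU inj unfolding full_rank_def by linarith
qed

section \<open>Homogeneous components of sums and products\<close>

lemma homogeneous_component_mult:
  fixes h q :: "('n::finite, 'k::comm_ring_1) mpoly"
  assumes h: "h \<in> homogeneous_part s"
  shows "homogeneous_component d (h * q) =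
    (if s \<le> d then h * homogeneous_component (d - s) q else 0)"
proof -
  \<comment> \<open>Inserting \<open>d - s\<close> ensures that, when \<open>s \<le> d\<close>, the
    shifted index set already contains \<open>d\<close>. When \<open>d < s\<close>, adding the index
    \<open>d\<close> later costs nothing, since \<open>?f d = 0\<close>. The zero branch of
    \<open>?f\<close> also makes \<open>?f e\<close> homogeneous of degree \<open>e\<close> for
    every \<open>e\<close>.\<close>
  let ?D = "insert (d - s) (mon_degree ` Poly_Mapping.keys q)"
  let ?f = "\<lambda>e. if s \<le> e then h * homogeneous_component (e - s) q else 0"
  have f: "?f e \<in> homogeneous_part e" for e
    using homogeneous_part_mult[OF h homogeneous_component_in, of "e - s" q]
    by (cases "s \<le> e") (simp_all add: homogeneous_part_0)
  have "h * q = (\<Sum>e\<in>?D. h * homogeneous_component e q)"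
    unfolding sum_distrib_left[symmetric]
    by (rule arg_cong[where f = "(*) h"], rule homogeneous_component_sum) auto
  also have "\<dots> = (\<Sum>e\<in>?D. ?f (e + s))" by simp
  also have "\<dots> = (\<Sum>e\<in>(\<lambda>e. e + s) ` ?D. ?f e)"
    by (subst sum.reindex) (auto simp: inj_on_def)
  also have "\<dots> = (\<Sum>e\<in>insert d ((\<lambda>e. e + s) ` ?D). ?f e)"
    by (rule sum.mono_neutral_left) (auto split: if_splits)
  finally show ?thesis
    using homogeneous_component_of_sum[of "insert d ((\<lambda>e. e + s) ` ?D)" ?f d] f by simp
qed

lemma homogeneous_component_add:
  "homogeneous_component d (p + q) = homogeneous_component d p + homogeneous_component d q"
  by (rule poly_mapping_eqI) (simp add: lookup_homogeneous_component lookup_add)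

lemma homogeneous_component_homogeneous:
  "p \<in> homogeneous_part d \<Longrightarrow> homogeneous_component d p = p"
  by (rule poly_mapping_eqI)
    (auto simp: lookup_homogeneous_component homogeneous_part_def in_keys_iff)

lemma homogeneous_part_power:
  fixes p :: "('n::finite, 'k::comm_ring_1) mpoly"
  assumes "p \<in> homogeneous_part d"
  shows "p ^ s \<in> homogeneous_part (s * d)"
proof (induction s)
  case 0
  show ?case using homogeneous_part_const[of "1::'k"] by simp
next
  case (Suc s)
  then show ?case using homogeneous_part_mult[OF assms Suc] by simp
qed

section \<open>Principal ideals, cosets and induced maps between quotients\<close>

text \<open>In a commutative ring the ideal generated by \<open>h\<close> is the set of its
  multiples.\<close>

lemma class_ring_add_genideal_iff:
  "p \<in> I <+>\<^bsub>class_ring\<^esub> Idl\<^bsub>class_ring\<^esub> {h} \<longleftrightarrow> (\<exists>a\<in>I. \<exists>q. p = a + h * q)"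
  for h :: "'a::comm_ring_1"
proof -
  have "Idl\<^bsub>class_ring\<^esub> {h} = range (\<lambda>q. q * h)"
    using cring.cgenideal_eq_genideal[OF class_cring.is_cring, of h] by (auto simp: cgenideal_def)
  then have "p \<in> I <+>\<^bsub>class_ring\<^esub> Idl\<^bsub>class_ring\<^esub> {h} \<longleftrightarrow> (\<exists>a\<in>I. \<exists>q. p = a + q * h)"
    by (simp add: set_add_def')
  then show ?thesis by (simp only: mult.commute)
qed

lemma quotient_algebra_power:
  fixes I :: "('n::finite, 'k::field) mpoly set"
  assumes "ideal I class_ring"
  shows "(I +>\<^bsub>class_ring\<^esub> p) [^]\<^bsub>quotient_algebra I\<^esub> (s::nat) = I +>\<^bsub>class_ring\<^esub> p ^ s"
proof (induction s)
  case 0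
  show ?case unfolding power_0 cls_one[OF assms] by (simp add: nat_pow_def)
next
  case (Suc s)
  have "(I +>\<^bsub>class_ring\<^esub> p) [^]\<^bsub>quotient_algebra I\<^esub> Suc s
      = (I +>\<^bsub>class_ring\<^esub> p) [^]\<^bsub>quotient_algebra I\<^esub> s \<otimes>\<^bsub>quotient_algebra I\<^esub> (I +>\<^bsub>class_ring\<^esub> p)"
    by (simp add: nat_pow_def)
  then show ?case unfolding Suc power_Suc2 cls_mult[OF assms] .
qed

text \<open>Common source of the two maps needed: \<open>f\<close> the identity yields the
  projection from \<open>S/I\<close> to \<open>S/J\<close>, and \<open>f\<close> multiplication by
  \<open>h\<close> yields the Lefschetz map on \<open>S/I\<close>. That \<open>f\<close> respects
  cosets is contained in the hypothesis \<open>f'\<close>, as \<open>f'\<close> is a function of the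
  coset.\<close>

lemma quotient_grade_linear_map:
  fixes I J :: "('n::finite, 'k::field) mpoly set"
  assumes I: "ideal I class_ring" and J: "ideal J class_ring"
    and f': "\<And>p. f' (I +>\<^bsub>class_ring\<^esub> p) = J +>\<^bsub>class_ring\<^esub> f p"
    and add: "\<And>p q. f (p + q) = f p + f q"
    and smult: "\<And>c p. f (Poly_Mapping.single 0 c * p) = Poly_Mapping.single 0 c * f p"
    and grade: "\<And>p. p \<in> homogeneous_part d \<Longrightarrow> f p \<in> homogeneous_part e"
  shows "linear_map (class_ring :: 'k ring) ((quotient_algebra I)\<lparr>carrier := quotient_grade I d\<rparr>)
    ((quotient_algebra J)\<lparr>carrier := quotient_grade J e\<rparr>) f'"
proof -
  have "mod_hom (class_ring :: 'k ring) ((quotient_algebra I)\<lparr>carrier := quotient_grade I d\<rparr>)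
    ((quotient_algebra J)\<lparr>carrier := quotient_grade J e\<rparr>) f'"
    using quotient_grade_vectorspace[OF I, of d] quotient_grade_vectorspace[OF J, of e]
    by (intro mod_hom.intro mod_hom_axioms.intro)
      (auto simp: vectorspace_def LinearCombinations.module_hom_def quotient_grade_def f' grade add smult
        cls_add[OF I, symmetric] cls_add[OF J, symmetric] cls_smult[OF I] cls_smult[OF J])
  then show ?thesis
    using quotient_grade_vectorspace[OF I, of d] quotient_grade_vectorspace[OF J, of e]
    by (simp add: linear_map_def)
qed

text \<open>The natural projection from \<open>S/I\<close> to \<open>S/J\<close> for
  \<open>I \<subseteq> J\<close>, defined without choosing representatives: all elements of a coset
  of \<open>I\<close> lie in the same coset of \<open>J\<close>, so the union is that single
  coset.\<close>

definition coset_lift :: "'a::comm_ring_1 set \<Rightarrow> 'a set \<Rightarrow> 'a set" where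
  "coset_lift J X = (\<Union>q\<in>X. J +>\<^bsub>class_ring\<^esub> q)"

lemma coset_lift_class:
  fixes I J :: "('n::finite, 'k::field) mpoly set"
  assumes I: "ideal I class_ring" and J: "ideal J class_ring" and "I \<subseteq> J"
  shows "coset_lift J (I +>\<^bsub>class_ring\<^esub> p) = J +>\<^bsub>class_ring\<^esub> p"
proof -
  have zero: "0 \<in> I"
    using additive_subgroup.zero_closed[OF ideal.axioms(1)[OF I]] by simp
  have "J +>\<^bsub>class_ring\<^esub> q = J +>\<^bsub>class_ring\<^esub> p" if "q \<in> I +>\<^bsub>class_ring\<^esub> p" for q
    using that \<open>I \<subseteq> J\<close> cls_eq_iff[OF J, of q p] by (auto simp: a_r_coset_def')
  moreover have "p \<in> I +>\<^bsub>class_ring\<^esub> p" using zero by (force simp: a_r_coset_def')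
  ultimately show ?thesis unfolding coset_lift_def by blast
qed

section \<open>The cokernel of multiplication by a form \<open>h\<close> of degree \<open>s\<close>,
  later taken to be \<open>ell ^ s\<close>\<close>

context
  fixes I J :: "('n::finite, 'k::field) mpoly set" and h :: "('n, 'k) mpoly" and s :: nat
  assumes I: "homogeneous_ideal I" and h: "h \<in> homogeneous_part s"
  defines "J \<equiv> I <+>\<^bsub>class_ring\<^esub> Idl\<^bsub>class_ring\<^esub> {h}"
begin

abbreviation (input) piece where
  "piece A d \<equiv> (quotient_algebra A)\<lparr>carrier := quotient_grade A d\<rparr>"

lemma ideal_I: "ideal I class_ring"
  using I by (simp add: homogeneous_ideal_def)

lemma ideal_J: "ideal J class_ring"
proof -
  have R: "ring (class_ring :: ('n, 'k) mpoly ring)" by (rule cring.axioms(1)[OF class_cring.is_cring])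
  show ?thesis
    unfolding J_def by (rule ring.add_ideals[OF R ideal_I ring.genideal_ideal[OF R]]) simp
qed

lemma I_subset_J: "I \<subseteq> J"
proof
  fix a assume "a \<in> I"
  then show "a \<in> J"
    unfolding J_def class_ring_add_genideal_iff by (intro bexI[of _ a] exI[of _ 0]) simp_all
qed

lemma coset_lift_I: "coset_lift J (I +>\<^bsub>class_ring\<^esub> p) = J +>\<^bsub>class_ring\<^esub> p"
  by (rule coset_lift_class[OF ideal_I ideal_J I_subset_J])

lemma coset_lift_linear_map:
  "linear_map (class_ring :: 'k ring) (piece I d) (piece J d) (coset_lift J)"
  by (rule quotient_grade_linear_map[OF ideal_I ideal_J, where f = "\<lambda>p. p"])
    (simp_all add: coset_lift_I)

lemma coset_lift_surj: "coset_lift J ` quotient_grade I d = quotient_grade J d"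
  by (simp add: quotient_grade_def image_image coset_lift_I)

text \<open>Homogeneity of \<open>I\<close> enters here. Taking the component of degree
  \<open>d\<close> in \<open>p = a + h * q\<close> leaves \<open>p\<close> unchanged, keeps
  \<open>a\<close> in \<open>I\<close>, and replaces \<open>q\<close> by its component of degree
  \<open>d - s\<close>; the product term vanishes if \<open>d < s\<close>.\<close>

lemma homogeneous_in_J_iff:
  assumes "p \<in> homogeneous_part d"
  shows "p \<in> J \<longleftrightarrow>
    (if s \<le> d then \<exists>q\<in>homogeneous_part (d - s). p - h * q \<in> I else p \<in> I)"
proof
  assume "p \<in> J"
  then obtain a q where "a \<in> I" and p: "p = a + h * q"
    unfolding J_def class_ring_add_genideal_iff by blast
  have a: "homogeneous_component d a \<in> I"
    using \<open>a \<in> I\<close> I by (simp add: homogeneous_ideal_def)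
  have p_eq: "p = homogeneous_component d a
      + (if s \<le> d then h * homogeneous_component (d - s) q else 0)"
    using homogeneous_component_homogeneous[OF assms]
    unfolding p homogeneous_component_add homogeneous_component_mult[OF h] by (rule sym)
  show "if s \<le> d then \<exists>q\<in>homogeneous_part (d - s). p - h * q \<in> I else p \<in> I"
  proof (cases "s \<le> d")
    case True
    then have "p - h * homogeneous_component (d - s) q = homogeneous_component d a"
      using p_eq by (simp add: algebra_simps)
    then have "p - h * homogeneous_component (d - s) q \<in> I" using a by simp
    then show ?thesis using True homogeneous_component_in[of "d - s" q] by auto
  next
    case False
    then show ?thesis using a p_eq by simp
  qed
next
  assume *: "if s \<le> d then \<exists>q\<in>homogeneous_part (d - s). p - h * q \<in> I else p \<in> I"
  have "\<exists>q. p - h * q \<in> I"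
  proof (cases "s \<le> d")
    case False
    with * show ?thesis by (intro exI[of _ 0]) simp
  qed (use * in auto)
  then obtain q where "p - h * q \<in> I" by blast
  then show "p \<in> J"
    unfolding J_def class_ring_add_genideal_iff
    by (intro bexI[of _ "p - h * q"] exI[of _ q]) simp_all
qed

lemma coset_lift_kernel:
  "{X \<in> quotient_grade I d. coset_lift J X = \<zero>\<^bsub>quotient_algebra J\<^esub>} =
    (\<lambda>p. I +>\<^bsub>class_ring\<^esub> p) ` (homogeneous_part d \<inter> J)"
proof -
  have "coset_lift J (I +>\<^bsub>class_ring\<^esub> p) = \<zero>\<^bsub>quotient_algebra J\<^esub> \<longleftrightarrow> p \<in> J" for p
    unfolding coset_lift_I cls_zero[OF ideal_J, symmetric] cls_eq_iff[OF ideal_J] by simp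
  then show ?thesis unfolding quotient_grade_def by blast
qed

lemma h_mult: "q \<in> homogeneous_part i \<Longrightarrow> h * q \<in> homogeneous_part (i + s)"
  using homogeneous_part_mult[OF h, of q i] by (simp add: add.commute)

lemma mult_linear_map:
  "linear_map (class_ring :: 'k ring) (piece I i) (piece I (i + s))
    (\<lambda>X. (I +>\<^bsub>class_ring\<^esub> h) \<otimes>\<^bsub>quotient_algebra I\<^esub> X)"
  by (rule quotient_grade_linear_map[OF ideal_I ideal_I, where f = "\<lambda>p. h * p"])
    (simp_all add: cls_mult[OF ideal_I] distrib_left mult.left_commute h_mult)

lemma full_rank_mult_iff:
  "full_rank (\<lambda>X. (I +>\<^bsub>class_ring\<^esub> h) \<otimes>\<^bsub>quotient_algebra I\<^esub> X)
      (quotient_grade I i) (quotient_grade I (i + s)) \<longleftrightarrow>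
    int (HF J (int (i + s))) = max (int (HF I (int (i + s))) - int (HF I (int i))) 0"
proof -
  let ?T = "\<lambda>X. (I +>\<^bsub>class_ring\<^esub> h) \<otimes>\<^bsub>quotient_algebra I\<^esub> X"
  \<comment> \<open>Exactness in the middle: the left side is the kernel of the projection in degree
    \<open>i + s\<close>, the right side the image of multiplication by \<open>h\<close> on degree
    \<open>i\<close>.\<close>
  have "(\<lambda>p. I +>\<^bsub>class_ring\<^esub> p) ` (homogeneous_part (i + s) \<inter> J)
      = (\<lambda>q. I +>\<^bsub>class_ring\<^esub> (h * q)) ` homogeneous_part i"
  proof (intro equalityI subsetI)
    fix X assume "X \<in> (\<lambda>p. I +>\<^bsub>class_ring\<^esub> p) ` (homogeneous_part (i + s) \<inter> J)"
    then obtain p where p: "p \<in> homogeneous_part (i + s)" "p \<in> J" and X: "X = I +>\<^bsub>class_ring\<^esub> p"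
      by blast
    then obtain q where "q \<in> homogeneous_part i" "p - h * q \<in> I"
      using homogeneous_in_J_iff[OF p(1)] by auto
    then show "X \<in> (\<lambda>q. I +>\<^bsub>class_ring\<^esub> (h * q)) ` homogeneous_part i"
      using cls_eq_iff[OF ideal_I] X by blast
  next
    fix X assume "X \<in> (\<lambda>q. I +>\<^bsub>class_ring\<^esub> (h * q)) ` homogeneous_part i"
    then obtain q where q: "q \<in> homogeneous_part i" and X: "X = I +>\<^bsub>class_ring\<^esub> (h * q)"
      by blast
    \<comment> \<open>The witness for \<open>h * q\<close> in \<open>homogeneous_in_J_iff\<close> is
      \<open>q\<close> itself, with remainder 0.\<close>
    have "0 \<in> I" using additive_subgroup.zero_closed[OF ideal.axioms(1)[OF ideal_I]] by simp
    then have "h * q \<in> J" using homogeneous_in_J_iff[OF h_mult[OF q]] q by (auto intro!: bexI[of _ q])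
    then show "X \<in> (\<lambda>p. I +>\<^bsub>class_ring\<^esub> p) ` (homogeneous_part (i + s) \<inter> J)"
      using h_mult[OF q] X by blast
  qed
  then have "{X \<in> quotient_grade I (i + s). coset_lift J X = \<zero>\<^bsub>quotient_algebra J\<^esub>}
      = ?T ` quotient_grade I i"
    unfolding coset_lift_kernel by (simp add: quotient_grade_def image_image cls_mult[OF ideal_I])
  then show ?thesis
    using full_rank_iff_dim_coker[OF mult_linear_map coset_lift_linear_map
        quotient_grade_fin_dim[OF ideal_I] quotient_grade_fin_dim[OF ideal_I], of i]
      coset_lift_surj[of "i + s"]
    by (simp add: HF_def del: of_nat_add)
qed

text \<open>Multiples of \<open>h\<close> contribute nothing to \<open>J\<close> in degrees below
  \<open>s\<close>, so the projection is also injective there and hence preserves dimension.\<close>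

lemma HF_below_degree:
  assumes "d < s"
  shows "HF J (int d) = HF I (int d)"
proof -
  interpret linear_map "class_ring :: 'k ring" "piece I d" "piece J d" "coset_lift J"
    by (rule coset_lift_linear_map)
  have "inj_on (coset_lift J) (quotient_grade I d)"
  proof (rule inj_onI)
    fix X Y assume "X \<in> quotient_grade I d" "Y \<in> quotient_grade I d" and eq: "coset_lift J X = coset_lift J Y"
    then obtain p q where pq: "p \<in> homogeneous_part d" "q \<in> homogeneous_part d"
      and [simp]: "X = I +>\<^bsub>class_ring\<^esub> p" "Y = I +>\<^bsub>class_ring\<^esub> q"
      by (auto simp: quotient_grade_def)
    have "p - q \<in> J"
      using eq by (simp add: coset_lift_I
          cls_eq_iff[OF ideal_J])
    then have "p - q \<in> I"
      using homogeneous_in_J_iff[OF homogeneous_part_diff[OF pq]] assms by simp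
    then show "X = Y" by (simp add: cls_eq_iff[OF ideal_I])
  qed
  then show ?thesis
    using dim_eq[OF quotient_grade_fin_dim[OF ideal_I]] coset_lift_surj[of d] by (simp add: HF_def)
qed

end

section \<open>From source degrees \<open>i\<close> of the Lefschetz maps to target degrees
  \<open>d = i + s\<close>\<close>

theorem proposition2p11:
  fixes I :: "('n::finite, 'k::field_char_0) mpoly set"
    and ell :: "('n, 'k) mpoly"
  assumes "homogeneous_ideal I"
    and "ell \<in> homogeneous_part 1"
  shows "strong_lefschetz_element (quotient_algebra I) (quotient_grade I) (I +>\<^bsub>class_ring\<^esub> ell)
    \<longleftrightarrow> (\<forall>s::nat. \<forall>d::nat. 1 \<le> s \<longrightarrow>
          int (HF (I <+>\<^bsub>class_ring\<^esub> Idl\<^bsub>class_ring\<^esub> {ell ^ s}) (int d))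
          = max (int (HF I (int d)) - int (HF I (int d - int s))) 0)"
    (is "?slp \<longleftrightarrow> (\<forall>s d. 1 \<le> s \<longrightarrow> ?hf s d)")
proof -
  let ?T = "\<lambda>s X. (I +>\<^bsub>class_ring\<^esub> ell) [^]\<^bsub>quotient_algebra I\<^esub> (s::nat)
    \<otimes>\<^bsub>quotient_algebra I\<^esub> X"
  have ideal: "ideal I class_ring" using assms(1) by (simp add: homogeneous_ideal_def)
  have power: "ell ^ s \<in> homogeneous_part s" for s
    using homogeneous_part_power[OF assms(2), of s] by simp
  have above: "full_rank (?T s) (quotient_grade I i) (quotient_grade I (i + s)) \<longleftrightarrow> ?hf s (i + s)"
    for i s
    using full_rank_mult_iff[OF assms(1) power, of s i]
    by (simp add: quotient_algebra_power[OF ideal])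
  \<comment> \<open>Here \<open>int d - int s\<close> is negative, so the subtracted value of
    \<open>HF I\<close> is 0 by convention and the maximum is \<open>HF I (int d)\<close>.\<close>
  have below: "?hf s d" if "d < s" for s d
    using HF_below_degree[OF assms(1) power that] that by (simp add: HF_def)
  \<comment> \<open>The degree-1 condition on the class of \<open>ell\<close> follows from
    \<open>assms(2)\<close>, so only the rank conditions remain.\<close>
  have "?slp \<longleftrightarrow> (\<forall>i s. 1 \<le> s \<longrightarrow> ?hf s (i + s))"
    using assms(2) by (simp only: strong_lefschetz_element_def above) (auto simp: quotient_grade_def)
  \<comment> \<open>The degrees \<open>i + s\<close> are exactly the \<open>d\<close> with
    \<open>s \<le> d\<close>; \<open>below\<close> supplies the others.\<close>
  also have "\<dots> \<longleftrightarrow> (\<forall>s d. 1 \<le> s \<longrightarrow> ?hf s d)"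
    using below by (metis le_add_diff_inverse2 not_less)
  finally show ?thesis .
qed

end
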